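(* Let $P_1(x_1)$, $P_2(x_2)$, $Q_0(x_0)$, $Q_1(x_1)$ be polynomials and let $n\in\mathbb{N}_0$. Then, wherever $P_2(x_2)\ne 0$ and $P_1^2(x_1)-4P_2(x_2)\neq 0$ (so that the right-hand side is defined), $$\begin{aligned}\mathbb{S}_n\left(P_1(x_1),P_2(x_2);Q_0(x_0),Q_1(x_1)\right)=&\frac{2^{n-1}\left(P_2(x_2)\right)^n}{\sqrt{P_1^2(x_1)-4P_2(x_2)}}\left(\frac{\left(P_1(x_1)+\sqrt{P_1^2(x_1)-4P_2(x_2)}\right)Q_0(x_0)-2Q_1(x_1)}{\left(-P_1(x_1)+\sqrt{P_1^2(x_1)-4P_2(x_2)}\right)^n}\right)\\&+\frac{2^{n-1}\left(P_2(x_2)\right)^n}{\sqrt{P_1^2(x_1)-4P_2(x_2)}}\left(\frac{\left(-P_1(x_1)+\sqrt{P_1^2(x_1)-4P_2(x_2)}\right)Q_0(x_0)+2Q_1(x_1)}{\left(-P_1(x_1)-\sqrt{P_1^2(x_1)-4P_2(x_2)}\right)^n}\right).\end{aligned}$$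
   Context: $\mathbb{N}_0=\{0,1,2,\ldots\}$. $P_1(x_1),P_2(x_2),Q_0(x_0),Q_1(x_1)$ are arbitrary polynomials in the indicated variables (say with complex coefficients, evaluated at complex $x_0,x_1,x_2$). The polynomials $\mathbb{S}_n(P_1(x_1),P_2(x_2);Q_0(x_0),Q_1(x_1))$, $n\ge 0$, are defined by the power series expansion in $w$ $$\frac{Q_0(x_0)+Q_1(x_1)w}{1+P_1(x_1)w+P_2(x_2)w^2}=\sum_{n=0}^{\infty}\mathbb{S}_n\left(P_1(x_1),P_2(x_2);Q_0(x_0),Q_1(x_1)\right)w^n.$$ The symbol $\sqrt{P_1^2(x_1)-4P_2(x_2)}$ denotes one fixed square root, the same in every occurrence. *)

theory Defs
  imports Complex_Main "HOL-Computational_Algebra.Computational_Algebra"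
begin

text \<open>
  The arguments are the values \<open>p1 = P\<^sub>1(x\<^sub>1)\<close>, \<open>p2 = P\<^sub>2(x\<^sub>2)\<close>, \<open>q0 = Q\<^sub>0(x\<^sub>0)\<close>, \<open>q1 = Q\<^sub>1(x\<^sub>1)\<close>
  at a point, so \<open>S_poly\<close> yields the value of the polynomial \<open>S\<^sub>n\<close> there. The denominator has
  constant term 1, hence the division in the ring of formal power series in \<open>w\<close> is exact
  (see \<open>S_poly_gen_fun\<close>) and the coefficients are polynomial in the arguments
  (see \<open>S_poly_rec\<close>).
\<close>

definition S_poly :: "nat \<Rightarrow> complex \<Rightarrow> complex \<Rightarrow> complex \<Rightarrow> complex \<Rightarrow> complex" where
  "S_poly n p1 p2 q0 q1 =
     fps_nth ((fps_const q0 + fps_const q1 * fps_X) /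
              (1 + fps_const p1 * fps_X + fps_const p2 * fps_X ^ 2)) n"

lemma S_poly_gen_fun:
  "(1 + fps_const p1 * fps_X + fps_const p2 * fps_X ^ 2) * Abs_fps (\<lambda>n. S_poly n p1 p2 q0 q1) =
     fps_const q0 + fps_const q1 * fps_X"
proof -
  let ?D = "1 + fps_const p1 * fps_X + fps_const p2 * fps_X ^ 2 :: complex fps"
  let ?N = "fps_const q0 + fps_const q1 * fps_X"
  have nz: "fps_nth ?D 0 \<noteq> 0" by simp
  have "Abs_fps (\<lambda>n. S_poly n p1 p2 q0 q1) = ?N / ?D"
    by (rule fps_ext) (simp add: S_poly_def)
  also have "\<dots> = ?N * inverse ?D"
    using nz by (rule fps_divide_unit)
  finally have "?D * Abs_fps (\<lambda>n. S_poly n p1 p2 q0 q1) = ?N * (inverse ?D * ?D)"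
    by (simp only: ac_simps)
  then show ?thesis
    using inverse_mult_eq_1[OF nz] by (simp only: mult_1_right)
qed

lemma S_poly_rec:
  "S_poly 0 p1 p2 q0 q1 = q0"
  "S_poly (Suc 0) p1 p2 q0 q1 = q1 - p1 * q0"
  "S_poly (Suc (Suc n)) p1 p2 q0 q1 = - p1 * S_poly (Suc n) p1 p2 q0 q1 - p2 * S_poly n p1 p2 q0 q1"
proof -
  let ?F = "Abs_fps (\<lambda>n. S_poly n p1 p2 q0 q1)"
  have eq: "?F + fps_const p1 * (fps_X * ?F) + fps_const p2 * (fps_X * (fps_X * ?F)) =
      fps_const q0 + fps_const q1 * fps_X"
    using S_poly_gen_fun[of p1 p2 q0 q1] by (simp add: algebra_simps power2_eq_square)
  show z: "S_poly 0 p1 p2 q0 q1 = q0"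
    using arg_cong[OF eq, of "\<lambda>f. fps_nth f 0"] by simp
  show "S_poly (Suc 0) p1 p2 q0 q1 = q1 - p1 * q0"
    using arg_cong[OF eq, of "\<lambda>f. fps_nth f 1"] z by (simp add: algebra_simps)
  show "S_poly (Suc (Suc n)) p1 p2 q0 q1 =
      - p1 * S_poly (Suc n) p1 p2 q0 q1 - p2 * S_poly n p1 p2 q0 q1"
    using arg_cong[OF eq, of "\<lambda>f. fps_nth f (Suc (Suc n))"]
    by (simp add: algebra_simps eq_neg_iff_add_eq_0)
qed

end

theory Submission
  imports Defs
begin

text \<open>
  Let \<open>a\<close> and \<open>b\<close> be the roots of \<open>t\<^sup>2 + p\<^sub>1 t + p\<^sub>2\<close>, so that \<open>1 + p\<^sub>1 w + p\<^sub>2 w\<^sup>2 = (1 - a w) (1 - b w)\<close>.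
  Since the discriminant does not vanish, \<open>a \<noteq> b\<close>, and partial fractions (equivalently, solving the
  recurrence of the coefficients) give the Binet form
  \<open>S\<^sub>n = (b\<^sup>n (b q\<^sub>0 + q\<^sub>1) - a\<^sup>n (a q\<^sub>0 + q\<^sub>1)) / (b - a)\<close>, which is \<open>S_poly_Binet\<close>.

  Here \<open>a = (- p\<^sub>1 - r) / 2\<close> and \<open>b = (- p\<^sub>1 + r) / 2\<close>, so \<open>b - a = r\<close>. The asserted formula has the
  roots in the denominators because \<open>a b = p\<^sub>2 \<noteq> 0\<close> makes each root a quotient by the other:
  \<open>a = 2 p\<^sub>2 / (- p\<^sub>1 + r)\<close> and \<open>b = 2 p\<^sub>2 / (- p\<^sub>1 - r)\<close>. Taking \<open>n\<close>-th powers yields the factor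
  \<open>2\<^sup>n p\<^sub>2\<^sup>n\<close>; the remaining factor \<open>1/2\<close> in \<open>2\<^sup>n\<^sup>-\<^sup>1\<close> compensates for writing the numerators as
  \<open>- 2 (a q\<^sub>0 + q\<^sub>1)\<close> and \<open>2 (b q\<^sub>0 + q\<^sub>1)\<close>.
\<close>

text \<open>
  Both \<open>a\<^sup>n\<close> and \<open>b\<^sup>n\<close> solve the recurrence with characteristic roots \<open>a\<close> and \<open>b\<close>, hence so does the
  right-hand side; it remains to compare two initial values. The equation is stated without
  division, so that it holds trivially for \<open>a = b\<close> as well.
\<close>

lemma S_poly_Binet:
  "(b - a) * S_poly n (- (a + b)) (a * b) q0 q1 = b ^ n * (b * q0 + q1) - a ^ n * (a * q0 + q1)"
proof (induction n rule: induct_nat_012)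
  case 0
  then show ?case by (simp add: S_poly_rec algebra_simps)
next
  case 1
  then show ?case by (simp add: S_poly_rec algebra_simps)
next
  case (ge2 n)
  have "(b - a) * S_poly (Suc (Suc n)) (- (a + b)) (a * b) q0 q1 =
      (a + b) * ((b - a) * S_poly (Suc n) (- (a + b)) (a * b) q0 q1)
        - a * b * ((b - a) * S_poly n (- (a + b)) (a * b) q0 q1)"
    by (simp add: S_poly_rec(3) algebra_simps)
  also have "\<dots> = b ^ Suc (Suc n) * (b * q0 + q1) - a ^ Suc (Suc n) * (a * q0 + q1)"
    unfolding ge2 by (simp add: algebra_simps)
  finally show ?case .
qed

theorem theorem13:
  fixes P1 P2 Q0 Q1 :: "complex poly" and x0 x1 x2 r :: complex and n :: nat
  assumes "poly P2 x2 \<noteq> 0"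
    and "(poly P1 x1)^2 - 4 * poly P2 x2 \<noteq> 0"
    and "r^2 = (poly P1 x1)^2 - 4 * poly P2 x2"
  shows "S_poly n (poly P1 x1) (poly P2 x2) (poly Q0 x0) (poly Q1 x1) =
      2 powi (int n - 1) * (poly P2 x2)^n / r *
        (((poly P1 x1 + r) * poly Q0 x0 - 2 * poly Q1 x1) / (- poly P1 x1 + r)^n)
    + 2 powi (int n - 1) * (poly P2 x2)^n / r *
        (((- poly P1 x1 + r) * poly Q0 x0 + 2 * poly Q1 x1) / (- poly P1 x1 - r)^n)"
proof -
  define p1 p2 q0 q1 where "p1 = poly P1 x1" and "p2 = poly P2 x2"
    and "q0 = poly Q0 x0" and "q1 = poly Q1 x1"
  note values_def = p1_def p2_def q0_def q1_def
  define a b where "a = (- p1 - r) / 2" and "b = (- p1 + r) / 2"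
  have r: "r \<noteq> 0"
    using assms(2,3) by auto
  have p2: "p2 \<noteq> 0"
    using assms(1) by (simp add: values_def)
  have prod: "a * b = p2"
    using assms(3) by (simp add: a_def b_def values_def field_simps power2_eq_square)
  have sum: "- (a + b) = p1" and diff: "b - a = r"
    by (simp_all add: a_def b_def field_simps)
  have denoms: "- p1 + r = 2 * b" "- p1 - r = 2 * a"
    by (simp_all add: a_def b_def)
  have numers: "(p1 + r) * q0 - 2 * q1 = - (2 * (a * q0 + q1))"
    "(- p1 + r) * q0 + 2 * q1 = 2 * (b * q0 + q1)"
    by (simp_all add: a_def b_def field_simps)
  have "a \<noteq> 0" "b \<noteq> 0"
    using prod p2 by auto
  then have powers: "p2 ^ n / (2 * b) ^ n = a ^ n / 2 ^ n" "p2 ^ n / (2 * a) ^ n = b ^ n / 2 ^ n"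
    by (simp_all add: prod[symmetric] power_mult_distrib)
  have half: "(2 :: complex) powi (int n - 1) = 2 ^ n / 2"
    by (simp add: power_int_diff)
  have first: "2 powi (int n - 1) * p2 ^ n / r * (((p1 + r) * q0 - 2 * q1) / (- p1 + r) ^ n) =
      - (a ^ n * (a * q0 + q1)) / r"
  proof -
    have "2 powi (int n - 1) * p2 ^ n / r * (((p1 + r) * q0 - 2 * q1) / (- p1 + r) ^ n) =
        2 ^ n / 2 / r * (- (2 * (a * q0 + q1))) * (p2 ^ n / (2 * b) ^ n)"
      unfolding numers denoms half by simp
    also have "\<dots> = - (a ^ n * (a * q0 + q1)) / r"
      unfolding powers using r by (simp add: field_simps)
    finally show ?thesis .
  qed
  have second: "2 powi (int n - 1) * p2 ^ n / r * (((- p1 + r) * q0 + 2 * q1) / (- p1 - r) ^ n) =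
      b ^ n * (b * q0 + q1) / r"
  proof -
    have "2 powi (int n - 1) * p2 ^ n / r * (((- p1 + r) * q0 + 2 * q1) / (- p1 - r) ^ n) =
        2 ^ n / 2 / r * (2 * (b * q0 + q1)) * (p2 ^ n / (2 * a) ^ n)"
      unfolding numers denoms half by simp
    also have "\<dots> = b ^ n * (b * q0 + q1) / r"
      unfolding powers using r by (simp add: field_simps)
    finally show ?thesis .
  qed
  have "r * S_poly n p1 p2 q0 q1 = b ^ n * (b * q0 + q1) - a ^ n * (a * q0 + q1)"
    using S_poly_Binet[of b a n q0 q1] unfolding sum prod diff .
  then have "S_poly n p1 p2 q0 q1 = (b ^ n * (b * q0 + q1) - a ^ n * (a * q0 + q1)) / r"
    using r by (simp add: eq_divide_eq mult.commute)
  also have "\<dots> = - (a ^ n * (a * q0 + q1)) / r + b ^ n * (b * q0 + q1) / r"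
    by (simp add: diff_divide_distrib)
  finally show ?thesis
    unfolding first[symmetric] second[symmetric] unfolding values_def .
qed

end
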